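(* Let $t_1,t_2,t_3\in\mathbb{R}$ be such that the operator $$\rho=\frac14\Big[\mathbb{I}_2\otimes\mathbb{I}_2+\sum_{i=1}^{3}t_i\,(\sigma_i\otimes\sigma_i)\Big]$$ on $\mathbb{C}^2\otimes\mathbb{C}^2$ is a density operator (a two-qubit Weyl state). Then $\rho$ is $F_3$ steerable if and only if its conditional Rényi 2-entropy is negative, i.e. $S_2(A|B)_\rho<0$.
   Context: $\sigma_1,\sigma_2,\sigma_3$ are the Pauli matrices and $\vec\sigma=(\sigma_1,\sigma_2,\sigma_3)$. A density operator is a positive semidefinite operator of unit trace. The first tensor factor is system $A$ and the second is system $B$. $F_3$ steerability (violation of the three-settings CJWR steering inequality): for unit vectors $\hat u_1,\hat u_2,\hat u_3\in\mathbb{R}^3$ and orthonormal vectors $\hat v_1,\hat v_2,\hat v_3\in\mathbb{R}^3$, write $\nu=\{\hat u_1,\hat u_2,\hat u_3,\hat v_1,\hat v_2,\hat v_3\}$, $A_l=\hat u_l\cdot\vec\sigma$, $B_l=\hat v_l\cdot\vec\sigma$, and $$F_3(\rho,\nu)=\frac{1}{\sqrt3}\Big|\sum_{l=1}^{3}\mathrm{Tr}\big(\rho\,(A_l\otimes B_l)\big)\Big|.$$ The CJWR inequality is $F_3(\rho,\nu)\le 1$. The state $\rho$ is called $F_3$ steerable if $F_3(\rho,\nu)>1$ for some choice of such $\nu$, and $F_3$ unsteerable otherwise. Rényi 2-entropy: $S_2(\rho)=-\log\mathrm{Tr}(\rho^2)$ (logarithm to base 2). Conditional Rényi 2-entropy: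 $S_2(A|B)_\rho=S_2(\rho)-S_2(\rho_B)$, where $\rho_B=\mathrm{Tr}_A\rho$. *)

theory Defs
  imports "HOL-Analysis.Analysis"
begin

text \<open>Operators on \<open>\<complex>\<^sup>n\<close> are complex matrices. An operator on the tensor product of
  \<open>\<complex>\<^sup>a\<close> (system A) and \<open>\<complex>\<^sup>b\<close> (system B) is a matrix indexed by pairs, the first component
  belonging to A and the second to B.\<close>

definition kron ::
  "complex^'a^'a \<Rightarrow> complex^'b^'b \<Rightarrow> complex^('a::finite \<times> 'b::finite)^('a \<times> 'b)"
  (infixr "\<otimes>\<^sub>K" 70)
  where "A \<otimes>\<^sub>K B = (\<chi> i j. A $ fst i $ fst j * B $ snd i $ snd j)"

definition partial_trace_A ::
  "complex^('a::finite \<times> 'b::finite)^('a \<times> 'b) \<Rightarrow> complex^'b^'b"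
  where "partial_trace_A M = (\<chi> i j. \<Sum>k\<in>UNIV. M $ (k, i) $ (k, j))"

definition hermitian :: "complex^'n^'n \<Rightarrow> bool"
  where "hermitian M \<longleftrightarrow> (\<forall>i j. M $ i $ j = cnj (M $ j $ i))"

text \<open>For a Hermitian matrix the quadratic form below is real, so taking its real part loses
  nothing.\<close>

definition positive_semidefinite :: "complex^'n^'n \<Rightarrow> bool"
  where "positive_semidefinite M \<longleftrightarrow>
    hermitian M \<and> (\<forall>v. 0 \<le> Re (\<Sum>i\<in>UNIV. cnj (v $ i) * (M *v v) $ i))"

definition density_operator :: "complex^'n^'n \<Rightarrow> bool"
  where "density_operator M \<longleftrightarrow> positive_semidefinite M \<and> trace M = 1"

definition pauli :: "(complex^2^2)^3"
  where "pauli = vector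
    [vector [vector [0, 1], vector [1, 0]],
     vector [vector [0, - \<i>], vector [\<i>, 0]],
     vector [vector [1, 0], vector [0, - 1]]]"

definition dot_pauli :: "real^3 \<Rightarrow> complex^2^2"
  where "dot_pauli u = (\<Sum>i\<in>UNIV. (u $ i) *\<^sub>R (pauli $ i))"

text \<open>The index type \<open>3\<close> enumerates the three measurement settings.\<close>

definition F3 :: "complex^(2 \<times> 2)^(2 \<times> 2) \<Rightarrow> (3 \<Rightarrow> real^3) \<Rightarrow> (3 \<Rightarrow> real^3) \<Rightarrow> real"
  where "F3 \<rho> u v =
    1 / sqrt 3 * cmod (\<Sum>l\<in>UNIV. trace (\<rho> ** (dot_pauli (u l) \<otimes>\<^sub>K dot_pauli (v l))))"

definition F3_steerable :: "complex^(2 \<times> 2)^(2 \<times> 2) \<Rightarrow> bool"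
  where "F3_steerable \<rho> \<longleftrightarrow>
    (\<exists>u v. (\<forall>l. norm (u l) = 1) \<and>
           (\<forall>l. norm (v l) = 1) \<and> (\<forall>l m. l \<noteq> m \<longrightarrow> orthogonal (v l) (v m)) \<and>
           F3 \<rho> u v > 1)"

text \<open>The trace of the square of a Hermitian matrix is real.\<close>

definition renyi2_entropy :: "complex^'n^'n \<Rightarrow> real"
  where "renyi2_entropy M = - log 2 (Re (trace (M ** M)))"

definition cond_renyi2_entropy ::
  "complex^('a::finite \<times> 'b::finite)^('a \<times> 'b) \<Rightarrow> real"
  where "cond_renyi2_entropy \<rho> = renyi2_entropy \<rho> - renyi2_entropy (partial_trace_A \<rho>)"

definition weyl_operator :: "real^3 \<Rightarrow> complex^(2 \<times> 2)^(2 \<times> 2)"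
  where "weyl_operator t =
    (1 / 4) *\<^sub>R (mat 1 \<otimes>\<^sub>K mat 1 + (\<Sum>i\<in>UNIV. (t $ i) *\<^sub>R (pauli $ i \<otimes>\<^sub>K pauli $ i)))"

end

theory Submission
  imports Defs
begin

text \<open>
  Writing \<open>T = diag(t\<^sub>1, t\<^sub>2, t\<^sub>3)\<close>, one has \<open>Tr(\<rho> (A\<^sub>l \<otimes> B\<^sub>l)) = u\<^sub>l \<bullet> T v\<^sub>l\<close>. By Cauchy--Schwarz, used
  once for each \<open>l\<close> and once for the sum over \<open>l\<close>, \<open>F\<^sub>3 \<le> \<parallel>T\<parallel>\<^sub>H\<^sub>S = \<parallel>t\<parallel>\<close>. The bound is attained: there is
  an orthonormal basis in which the diagonal of \<open>T\<^sup>2\<close> is constant, so that all \<open>\<parallel>T v\<^sub>l\<parallel>\<close> agree, and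
  \<open>u\<^sub>l\<close> is taken parallel to \<open>T v\<^sub>l\<close>. Hence \<open>\<rho>\<close> is steerable iff \<open>\<parallel>t\<parallel> > 1\<close>. On the other side,
  \<open>Tr \<rho>\<^sup>2 = (1 + \<parallel>t\<parallel>\<^sup>2) / 4\<close> and \<open>Tr \<rho>\<^sub>B\<^sup>2 = 1 / 2\<close>, so the conditional entropy is negative under
  the same condition.
\<close>

section \<open>Kronecker products and traces\<close>

lemma sum_prod_UNIV:
  "(\<Sum>p\<in>(UNIV :: ('a::finite \<times> 'b::finite) set). f p) = (\<Sum>a\<in>UNIV. \<Sum>b\<in>UNIV. f (a, b))"
  by (simp add: sum.cartesian_product)

lemma kron_mult:
  "(A \<otimes>\<^sub>K B) ** (C \<otimes>\<^sub>K D) = (A ** C) \<otimes>\<^sub>K (B ** D)"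
  by (simp add: vec_eq_iff kron_def matrix_matrix_mult_def sum_prod_UNIV sum_product mult.assoc
      mult.left_commute)

lemma trace_kron: "trace (A \<otimes>\<^sub>K B) = trace A * trace B"
  by (simp add: kron_def trace_def sum_prod_UNIV sum_product)

lemma scaleR_matrix_mult:
  fixes A :: "complex^'n^'m" and B :: "complex^'k^'n"
  shows "(c *\<^sub>R A) ** B = c *\<^sub>R (A ** B)"
  by (simp add: vec_eq_iff matrix_matrix_mult_def scaleR_sum_right)

lemma matrix_mult_scaleR:
  fixes A :: "complex^'n^'m" and B :: "complex^'k^'n"
  shows "A ** (c *\<^sub>R B) = c *\<^sub>R (A ** B)"
  by (simp add: vec_eq_iff matrix_matrix_mult_def scaleR_sum_right)

lemma matrix_add_mult_distrib:
  fixes A B :: "complex^'n^'m" and C :: "complex^'k^'n"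
  shows "(A + B) ** C = A ** C + B ** C"
  by (simp add: vec_eq_iff matrix_matrix_mult_def distrib_right sum.distrib)

lemma trace_scaleR:
  fixes A :: "complex^'n^'n"
  shows "trace (c *\<^sub>R A) = of_real c * trace A"
  by (simp add: trace_def sum_distrib_left scaleR_conv_of_real[where 'a = complex])

lemma partial_trace_A_kron: "partial_trace_A (A \<otimes>\<^sub>K B) = (\<chi> i j. trace A * B $ i $ j)"
  by (simp add: vec_eq_iff partial_trace_A_def kron_def trace_def sum_distrib_right)

lemma partial_trace_A_add: "partial_trace_A (M + N) = partial_trace_A M + partial_trace_A N"
  by (simp add: vec_eq_iff partial_trace_A_def sum.distrib)

lemma partial_trace_A_scaleR: "partial_trace_A (c *\<^sub>R M) = c *\<^sub>R partial_trace_A M"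
  by (simp add: vec_eq_iff partial_trace_A_def scaleR_sum_right)

section \<open>Pauli matrices\<close>

lemma trace_pauli: "trace (pauli $ i) = 0"
  using exhaust_3[of i] by (auto simp: pauli_def trace_def sum_2)

lemma trace_dot_pauli: "trace (dot_pauli u) = 0"
  by (simp add: dot_pauli_def sum_3 trace_add trace_scaleR trace_pauli)

lemma trace_pauli_mult:
  "trace (pauli $ i ** pauli $ j) = (if i = j then 2 else 0)"
  using exhaust_3[of i] exhaust_3[of j]
  by (auto simp: pauli_def trace_def matrix_matrix_mult_def sum_2)

lemma trace_pauli_dot_pauli: "trace (pauli $ i ** dot_pauli u) = 2 * of_real (u $ i)"
  using exhaust_3[of i]
  by (auto simp: dot_pauli_def sum_3 matrix_add_ldistrib matrix_mult_scaleR trace_add trace_scaleR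
      trace_pauli_mult)

section \<open>Weyl operators\<close>

text \<open>The identity term drops out because \<open>dot_pauli\<close> is traceless. Trace
  orthogonality of the Pauli matrices extracts one coordinate per factor, and the resulting 2 * 2
  cancels the 1/4.\<close>

lemma trace_weyl_mult_kron_dot_pauli:
  "trace (weyl_operator t ** (dot_pauli u \<otimes>\<^sub>K dot_pauli v)) =
    of_real (\<Sum>i\<in>UNIV. t $ i * u $ i * v $ i)"
  by (simp add: weyl_operator_def sum_3 scaleR_matrix_mult matrix_add_mult_distrib trace_scaleR trace_add
      kron_mult trace_kron trace_dot_pauli trace_pauli_dot_pauli algebra_simps)

lemma trace_weyl_square:
  "trace (weyl_operator t ** weyl_operator t) = of_real ((1 + (norm t)\<^sup>2) / 4)"
  by (simp add: weyl_operator_def sum_3 scaleR_matrix_mult matrix_mult_scaleR matrix_add_mult_distrib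
      matrix_add_ldistrib trace_scaleR trace_add kron_mult trace_kron trace_pauli trace_pauli_mult
      trace_I norm_vec_def L2_set_def)
    (simp add: power2_eq_square)

text \<open>Each correlation term has a traceless A factor, so only the identity term survives: the
  marginal is maximally mixed.\<close>

lemma partial_trace_A_weyl: "partial_trace_A (weyl_operator t) = (1 / 2) *\<^sub>R mat 1"
  by (simp add: weyl_operator_def sum_3 partial_trace_A_add partial_trace_A_scaleR
      partial_trace_A_kron trace_pauli trace_I vec_eq_iff)

lemma cond_renyi2_entropy_weyl_neg_iff:
  "cond_renyi2_entropy (weyl_operator t) < 0 \<longleftrightarrow> norm t > 1"
proof -
  have B: "trace (partial_trace_A (weyl_operator t) ** partial_trace_A (weyl_operator t)) = 1 / 2"
    by (simp add: partial_trace_A_weyl scaleR_matrix_mult matrix_mult_scaleR trace_scaleR trace_I)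
  have pos: "0 < (1 + (norm t)\<^sup>2) / 4"
    by (simp add: add_pos_nonneg)
  have "cond_renyi2_entropy (weyl_operator t) < 0 \<longleftrightarrow> log 2 (1 / 2) < log 2 ((1 + (norm t)\<^sup>2) / 4)"
    unfolding cond_renyi2_entropy_def renyi2_entropy_def B trace_weyl_square Re_complex_of_real
    by simp
  also have "\<dots> \<longleftrightarrow> 1 < (norm t)\<^sup>2"
    using pos by (subst log_less_cancel_iff) (auto simp: field_simps)
  also have "\<dots> \<longleftrightarrow> norm t > 1"
    by (smt (verit) norm_ge_zero one_less_power one_power2 pos2 power_mono)
  finally show ?thesis .
qed

section \<open>The optimal value of the steering functional\<close>

lemma F3_weyl:
  "F3 (weyl_operator t) u v = \<bar>\<Sum>l\<in>UNIV. u l \<bullet> (\<chi> i. t $ i * v l $ i)\<bar> / sqrt 3"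
proof -
  have "(\<Sum>l\<in>UNIV. trace (weyl_operator t ** (dot_pauli (u l) \<otimes>\<^sub>K dot_pauli (v l)))) =
      of_real (\<Sum>l\<in>UNIV. u l \<bullet> (\<chi> i. t $ i * v l $ i))"
    by (simp add: trace_weyl_mult_kron_dot_pauli inner_vec_def mult_ac)
  then show ?thesis
    unfolding F3_def by (simp only: norm_of_real) simp
qed

text \<open>For a square matrix a right inverse is also a left inverse, so orthonormal rows force
  orthonormal columns.\<close>

lemma orthonormal_columns:
  fixes v :: "'n \<Rightarrow> real^'n::finite"
  assumes "\<And>l. norm (v l) = 1" "\<And>l m. l \<noteq> m \<Longrightarrow> orthogonal (v l) (v m)"
  shows "(\<Sum>l\<in>UNIV. (v l $ i)\<^sup>2) = 1"
proof -
  define V where "V = (\<chi> l. v l)"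
  have "V ** transpose V = mat 1"
    using assms
    by (auto simp: V_def vec_eq_iff matrix_matrix_mult_def transpose_def mat_def orthogonal_def
        norm_eq_1 inner_vec_def)
  then have "transpose V ** V = mat 1"
    by (simp add: matrix_left_right_inverse)
  then have "(transpose V ** V) $ i $ i = 1"
    by (simp add: mat_def)
  then show ?thesis
    by (simp add: V_def matrix_matrix_mult_def transpose_def power2_eq_square)
qed

lemma F3_weyl_le:
  assumes u: "\<And>l. norm (u l) = 1"
    and v: "\<And>l. norm (v l) = 1" "\<And>l m. l \<noteq> m \<Longrightarrow> orthogonal (v l) (v m)"
  shows "F3 (weyl_operator t) u v \<le> norm t"
proof -
  define w where "w l = (\<chi> i. t $ i * v l $ i)" for l
  have "(\<Sum>l\<in>UNIV. (norm (w l))\<^sup>2) = (\<Sum>l\<in>UNIV. \<Sum>i\<in>UNIV. (t $ i)\<^sup>2 * (v l $ i)\<^sup>2)"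
    by (simp add: w_def norm_vec_def L2_set_def power_mult_distrib sum_nonneg)
  also have "\<dots> = (\<Sum>i\<in>UNIV. (t $ i)\<^sup>2 * (\<Sum>l\<in>UNIV. (v l $ i)\<^sup>2))"
    by (subst sum.swap) (simp add: sum_distrib_left)
  also have "\<dots> = (norm t)\<^sup>2"
    by (simp add: orthonormal_columns[OF v] norm_vec_def L2_set_def sum_nonneg)
  finally have sq: "(\<Sum>l\<in>UNIV. (norm (w l))\<^sup>2) = (norm t)\<^sup>2" .
  have "\<bar>\<Sum>l\<in>UNIV. u l \<bullet> w l\<bar> \<le> (\<Sum>l\<in>UNIV. \<bar>u l \<bullet> w l\<bar>)"
    by (rule sum_abs)
  \<comment> \<open>The explicit factor 1 prepares Cauchy-Schwarz over l; the constant sequence has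
    norm sqrt 3, which cancels the prefactor of \<open>F3\<close>.\<close>
  also have "\<dots> \<le> (\<Sum>l\<in>UNIV. \<bar>1\<bar> * \<bar>norm (w l)\<bar>)"
    using Cauchy_Schwarz_ineq2[of "u _" "w _"] by (intro sum_mono) (simp add: u)
  also have "\<dots> \<le> L2_set (\<lambda>l. 1) (UNIV :: 3 set) * L2_set (\<lambda>l. norm (w l)) UNIV"
    by (rule L2_set_mult_ineq)
  also have "\<dots> = sqrt 3 * norm t"
    unfolding L2_set_def sq by simp
  finally show ?thesis
    unfolding F3_weyl by (simp add: w_def field_simps)
qed

text \<open>Intermediate value theorem: a quarter turn changes the value from a to -a, so some angle
  between gives zero.\<close>

lemma exists_equalizing_rotation:
  fixes a b :: real
  obtains c s :: real where "c\<^sup>2 + s\<^sup>2 = 1" "a * (c\<^sup>2 - s\<^sup>2) + b * (c * s) = 0"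
proof -
  define g where "g \<theta> = a * ((cos \<theta>)\<^sup>2 - (sin \<theta>)\<^sup>2) + b * (cos \<theta> * sin \<theta>)" for \<theta>
  have cont: "continuous_on {0..pi/2} g"
    unfolding g_def by (intro continuous_intros)
  have ends: "g 0 = a" "g (pi/2) = - a"
    by (auto simp: g_def)
  have "\<exists>\<theta>\<in>{0..pi/2}. g \<theta> = 0"
  proof (cases "a \<le> 0")
    case True
    then show ?thesis
      using IVT'[of g 0 0 "pi/2"] cont ends by auto
  next
    case False
    then show ?thesis
      using IVT2'[of g "pi/2" 0 0] cont ends by auto
  qed
  then obtain \<theta> where "g \<theta> = 0"
    by blast
  then show thesis
    using that[of "cos \<theta>" "sin \<theta>"] by (simp add: g_def)
qed

text \<open>
  The quadratic form \<open>\<Sum> d\<^sub>i x\<^sub>i\<^sup>2\<close> takes the mean value at \<open>(1,1,1)/\<surd>3\<close>; the remaining two vectors are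
  the rotation of an orthonormal basis of the complement that balances the form there.
\<close>
lemma exists_equalizing_orthonormal_basis:
  fixes d :: "real^3"
  obtains v :: "3 \<Rightarrow> real^3"
  where "\<And>l. norm (v l) = 1" "\<And>l m. l \<noteq> m \<Longrightarrow> orthogonal (v l) (v m)"
    "\<And>l. (\<Sum>i\<in>UNIV. d $ i * (v l $ i)\<^sup>2) = (\<Sum>i\<in>UNIV. d $ i) / 3"
proof -
  define p q r :: real where "p = 1 / sqrt 3" and "q = 1 / sqrt 2" and "r = 1 / sqrt 6"
  have sq: "p\<^sup>2 = 1/3" "q\<^sup>2 = 1/2" "r\<^sup>2 = 1/6"
    by (auto simp: p_def q_def r_def power_divide)
  \<comment> \<open>Let e = q(1,-1,0) and f = r(1,1,-2), an orthonormal basis of the complement of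
    (1,1,1). The coefficients are half the difference of the form at e and f, and twice its polar
    value at (e,f). Below, v 2 = c e + s f and v 3 = -s e + c f.\<close>
  obtain c s where cs: "c\<^sup>2 + s\<^sup>2 = 1"
    and eq: "(d $ 1 / 6 + d $ 2 / 6 - d $ 3 / 3) * (c\<^sup>2 - s\<^sup>2)
      + (2 * q * r * (d $ 1 - d $ 2)) * (c * s) = 0"
    by (rule exists_equalizing_rotation)
  define v :: "3 \<Rightarrow> real^3" where "v l =
    (if l = 1 then vector [p, p, p]
     else if l = 2 then vector [c * q + s * r, - c * q + s * r, - 2 * s * r]
     else vector [- s * q + c * r, s * q + c * r, - 2 * c * r])" for l
  have square: "p * p = 1/3" "q * q = 1/2" "r * r = 1/6" "s * s = 1 - c * c"
    using sq cs by (simp_all add: power2_eq_square)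
  \<comment> \<open>\<open>algebra_simps\<close> nests products to the right, so the squares must
    also be recognised in front of a further factor.\<close>
  have "q * (q * x) = x/2" "r * (r * x) = x/6" "s * (s * x) = x - c * (c * x)" for x
    by (simp_all add: square left_diff_distrib flip: mult.assoc)
  note reduce = this square
  have norm: "norm (v l) = 1" for l
    using exhaust_3[of l]
    by (auto simp: v_def norm_eq_1 inner_vec_def sum_3 algebra_simps reduce)
  have orth: "orthogonal (v l) (v m)" if "l \<noteq> m" for l m
    using exhaust_3[of l] exhaust_3[of m] that
    by (auto simp: v_def orthogonal_def inner_vec_def sum_3 algebra_simps reduce)
  have mean: "(\<Sum>i\<in>UNIV. d $ i * (v l $ i)\<^sup>2) = (\<Sum>i\<in>UNIV. d $ i) / 3" for l
  proof -
    let ?e = "(d $ 1 / 6 + d $ 2 / 6 - d $ 3 / 3) * (c\<^sup>2 - s\<^sup>2)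
      + (2 * q * r * (d $ 1 - d $ 2)) * (c * s)"
    let ?m = "(d $ 1 + d $ 2 + d $ 3) / 3"
    have "d $ 1 * (c * q + s * r)\<^sup>2 + d $ 2 * (- c * q + s * r)\<^sup>2 + d $ 3 * (- 2 * s * r)\<^sup>2 =
        (d $ 1 + d $ 2) * c\<^sup>2 * q\<^sup>2 + (d $ 1 + d $ 2 + 4 * d $ 3) * s\<^sup>2 * r\<^sup>2
          + 2 * q * r * (d $ 1 - d $ 2) * (c * s)"
      by (simp add: power2_eq_square algebra_simps)
    also have "\<dots> = ?m * (c\<^sup>2 + s\<^sup>2) + ?e"
      unfolding sq by (simp add: field_simps)
    finally have 2: "d $ 1 * (c * q + s * r)\<^sup>2 + d $ 2 * (- c * q + s * r)\<^sup>2
        + d $ 3 * (- 2 * s * r)\<^sup>2 = ?m"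
      unfolding cs eq by simp
    have "d $ 1 * (- s * q + c * r)\<^sup>2 + d $ 2 * (s * q + c * r)\<^sup>2 + d $ 3 * (- 2 * c * r)\<^sup>2 =
        (d $ 1 + d $ 2) * s\<^sup>2 * q\<^sup>2 + (d $ 1 + d $ 2 + 4 * d $ 3) * c\<^sup>2 * r\<^sup>2
          - 2 * q * r * (d $ 1 - d $ 2) * (c * s)"
      by (simp add: power2_eq_square algebra_simps)
    \<comment> \<open>The form has trace 2 * \<open>?m\<close> on the complement, so the deviation
      from the mean is opposite to that at v 2.\<close>
    also have "\<dots> = ?m * (c\<^sup>2 + s\<^sup>2) - ?e"
      unfolding sq by (simp add: field_simps)
    finally have 3: "d $ 1 * (- s * q + c * r)\<^sup>2 + d $ 2 * (s * q + c * r)\<^sup>2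
        + d $ 3 * (- 2 * c * r)\<^sup>2 = ?m"
      unfolding cs eq by simp
    have 1: "d $ 1 * p\<^sup>2 + d $ 2 * p\<^sup>2 + d $ 3 * p\<^sup>2 = ?m"
      unfolding sq by simp
    show ?thesis
      using exhaust_3[of l]
    proof (elim disjE)
      assume "l = 1"
      with 1 show ?thesis by (simp add: v_def sum_3)
    next
      assume "l = 2"
      with 2 show ?thesis by (simp add: v_def sum_3)
    next
      assume "l = 3"
      with 3 show ?thesis by (simp add: v_def sum_3)
    qed
  qed
  show thesis
    using that norm orth mean by blast
qed

lemma exists_F3_weyl_eq:
  assumes "t \<noteq> 0"
  obtains u v where "\<And>l. norm (u l) = 1"
    "\<And>l. norm (v l) = 1" "\<And>l m. l \<noteq> m \<Longrightarrow> orthogonal (v l) (v m)"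
    "F3 (weyl_operator t) u v = norm t"
proof -
  \<comment> \<open>With the squares of the t_i as weights, the balanced form at v l is the squared
    norm of T (v l).\<close>
  obtain v :: "3 \<Rightarrow> real^3" where v: "\<And>l. norm (v l) = 1" "\<And>l m. l \<noteq> m \<Longrightarrow> orthogonal (v l) (v m)"
    and mean: "\<And>l. (\<Sum>i\<in>UNIV. (\<chi> i. (t $ i)\<^sup>2) $ i * (v l $ i)\<^sup>2)
      = (\<Sum>i\<in>UNIV. (\<chi> i. (t $ i)\<^sup>2) $ i) / 3"
    by (rule exists_equalizing_orthonormal_basis[of "\<chi> i. (t $ i)\<^sup>2"]) blast
  define w where "w l = (\<chi> i. t $ i * v l $ i)" for l
  have "(norm (w l))\<^sup>2 = (norm t)\<^sup>2 / 3" for l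
    using mean[of l] by (simp add: w_def norm_vec_def L2_set_def power_mult_distrib sum_nonneg)
  then have norm_w: "norm (w l) = norm t / sqrt 3" for l
    by (metis norm_ge_zero real_sqrt_abs real_sqrt_divide abs_norm_cancel)
  define u where "u l = w l /\<^sub>R norm (w l)" for l
  have w0: "w l \<noteq> 0" for l
    using norm_w[of l] assms by auto
  have u: "norm (u l) = 1" for l
    using w0[of l] by (simp add: u_def)
  have "u l \<bullet> w l = norm (w l)" for l
    using w0[of l] by (simp add: u_def dot_square_norm power2_eq_square)
  \<comment> \<open>Three equal terms norm t / sqrt 3, divided by sqrt 3, give norm t.\<close>
  then have "F3 (weyl_operator t) u v = norm t"
    unfolding F3_weyl w_def[symmetric] by (simp add: norm_w real_div_sqrt)
  then show thesis
    using that u v by blast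
qed

lemma F3_steerable_weyl_iff: "F3_steerable (weyl_operator t) \<longleftrightarrow> norm t > 1"
proof
  assume "F3_steerable (weyl_operator t)"
  then show "norm t > 1"
    unfolding F3_steerable_def using F3_weyl_le by (meson less_le_trans)
next
  assume t: "norm t > 1"
  then have "t \<noteq> 0"
    by auto
  then obtain u v where uv: "\<And>l. norm (u l) = 1"
    "\<And>l. norm (v l) = 1" "\<And>l m. l \<noteq> m \<Longrightarrow> orthogonal (v l) (v m)"
    "F3 (weyl_operator t) u v = norm t"
    by (rule exists_F3_weyl_eq) blast
  show "F3_steerable (weyl_operator t)"
    unfolding F3_steerable_def using uv t by (intro exI[of _ u] exI[of _ v]) simp
qed

theorem theorem1:
  fixes t :: "real^3" and \<rho> :: "complex^(2 \<times> 2)^(2 \<times> 2)"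
  assumes "\<rho> = weyl_operator t"
    and "density_operator \<rho>"
  shows "F3_steerable \<rho> \<longleftrightarrow> cond_renyi2_entropy \<rho> < 0"
  using assms by (simp add: F3_steerable_weyl_iff cond_renyi2_entropy_weyl_neg_iff)

end
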